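(* Let $K\ge 1$, $n\ge 1$, $a\in(0,1)$, and let $(\theta_1,\boldsymbol{\xi}_1),\dots,(\theta_n,\boldsymbol{\xi}_n)$ follow the random effects model described in the context. Let $\{D_t, 0\le t\le 1\}$ be a family of Borel sets in $[0,1]^K$ such that $D_1=[0,1]^K$, $\ell(D_t)=t$ for all $t$, $D_s\subset D_t$ for $0\le s<t\le 1$, and $D_t=\bigcap_{s>t}D_s$ for $t\in[0,1)$. Let $\alpha\in(0,1)$ and consider the procedure that rejects $H_i$ if and only if $\boldsymbol{\xi}_i\in D_\tau$, where $$\tau=\sup\left\{t\in[0,1]:\ \frac{t}{\alpha}\le\frac{R(t)\vee 1}{n}\right\},\qquad R(t)=\sum_{i=1}^n\mathbf{1}\{\boldsymbol{\xi}_i\in D_t\}.$$ Then this procedure satisfies $\mathrm{FDR}=(1-a)\alpha$.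
   Context: $\ell$ is Lebesgue measure and $x\vee y=\max(x,y)$. Random effects model: $H_1,\dots,H_n$ are null hypotheses, $\theta_i=\mathbf{1}\{H_i\text{ is false}\}$, and $\boldsymbol{\xi}_i=(\xi_{i1},\dots,\xi_{iK})'\in[0,1]^K$ is the multivariate $p$-value of $H_i$. The pairs $(\theta_i,\boldsymbol{\xi}_i)$ are i.i.d.; $\theta_i\sim\mathrm{Bernoulli}(a)$, i.e. $P(\theta_i=1)=a$; given $\theta_i=0$, $\xi_{i1},\dots,\xi_{iK}$ are i.i.d. $\sim\mathrm{Unif}(0,1)$; given $\theta_i=1$, $\boldsymbol{\xi}_i\sim G$, a distribution on $[0,1]^K$ with density $g$. For a multiple testing procedure, $R$ denotes the number of rejected nulls, $V$ the number of rejected true nulls (those with $\theta_i=0$), and $\mathrm{FDR}=E[V/(R\vee1)]$. *)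

theory Defs
  imports "HOL-Probability.Probability"
begin

definition unit_cube :: "(real ^ 'k) set" where
  "unit_cube = {x. \<forall>j. x $ j \<in> {0..1}}"

(* The dimension K is CARD('k), and theta i w means that H_i is false.  Conditional laws are laws
   under uniform_measure M E, that is P(- | E); both conditioning events have positive probability
   when 0 < a < 1.  The pairs are identically distributed because a and g do not depend on i. *)
locale random_effects_model = prob_space M
  for M :: "'a measure" +
  fixes n :: nat and a :: real and g :: "real ^ 'k \<Rightarrow> real"
    and \<theta> :: "nat \<Rightarrow> 'a \<Rightarrow> bool" and \<xi> :: "nat \<Rightarrow> 'a \<Rightarrow> real ^ 'k"
  assumes \<xi>_in_cube: "\<And>i \<omega>. i \<in> {1..n} \<Longrightarrow> \<omega> \<in> space M \<Longrightarrow> \<xi> i \<omega> \<in> unit_cube"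
    and indep_pairs:
      "indep_vars (\<lambda>_. count_space UNIV \<Otimes>\<^sub>M borel) (\<lambda>i \<omega>. (\<theta> i \<omega>, \<xi> i \<omega>)) {1..n}"
    and \<theta>_bernoulli:
      "\<And>i. i \<in> {1..n} \<Longrightarrow> distr M (count_space UNIV) (\<theta> i) = measure_pmf (bernoulli_pmf a)"
    and null_indep:
      "\<And>i. i \<in> {1..n} \<Longrightarrow>
        prob_space.indep_vars (uniform_measure M {\<omega> \<in> space M. \<not> \<theta> i \<omega>})
          (\<lambda>_. borel) (\<lambda>j \<omega>. \<xi> i \<omega> $ j) UNIV"
    and null_uniform:
      "\<And>i j. i \<in> {1..n} \<Longrightarrow>
        distr (uniform_measure M {\<omega> \<in> space M. \<not> \<theta> i \<omega>}) borel (\<lambda>\<omega>. \<xi> i \<omega> $ j)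
          = uniform_measure lborel {0<..<1}"
    and g_nonneg: "\<And>x. x \<in> unit_cube \<Longrightarrow> 0 \<le> g x"
    and alternative_density:
      "\<And>i. i \<in> {1..n} \<Longrightarrow>
        distributed (uniform_measure M {\<omega> \<in> space M. \<theta> i \<omega>}) lborel (\<xi> i)
          (\<lambda>x. ennreal (g x) * indicator unit_cube x)"

(* A multiple testing procedure is given by the random set of indices of the rejected nulls. *)
definition FDR :: "'a measure \<Rightarrow> (nat \<Rightarrow> 'a \<Rightarrow> bool) \<Rightarrow> ('a \<Rightarrow> nat set) \<Rightarrow> real" where
  "FDR M \<theta> rej =
    (\<integral>\<omega>. real (card {i \<in> rej \<omega>. \<not> \<theta> i \<omega>}) / real (max (card (rej \<omega>)) 1) \<partial>M)"

definition region_count ::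
    "nat \<Rightarrow> (nat \<Rightarrow> 'a \<Rightarrow> real ^ 'k) \<Rightarrow> (real \<Rightarrow> (real ^ 'k) set) \<Rightarrow> 'a \<Rightarrow> real \<Rightarrow> nat" where
  "region_count n \<xi> D \<omega> t = (\<Sum>i=1..n. indicator (D t) (\<xi> i \<omega>))"

definition threshold ::
    "nat \<Rightarrow> real \<Rightarrow> (nat \<Rightarrow> 'a \<Rightarrow> real ^ 'k) \<Rightarrow> (real \<Rightarrow> (real ^ 'k) set) \<Rightarrow> 'a \<Rightarrow> real" where
  "threshold n \<alpha> \<xi> D \<omega> =
    Sup {t \<in> {0..1}. t / \<alpha> \<le> real (max (region_count n \<xi> D \<omega> t) 1) / real n}"

definition rejections ::
    "nat \<Rightarrow> real \<Rightarrow> (nat \<Rightarrow> 'a \<Rightarrow> real ^ 'k) \<Rightarrow> (real \<Rightarrow> (real ^ 'k) set) \<Rightarrow> 'a \<Rightarrow> nat set" where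
  "rejections n \<alpha> \<xi> D \<omega> = {i \<in> {1..n}. \<xi> i \<omega> \<in> D (threshold n \<alpha> \<xi> D \<omega>)}"

end

theory Submission
  imports Defs
begin

text \<open>
  The procedure only looks at the regions \<open>D t\<close> through the grid \<open>t = \<alpha> * k / n\<close> with
  \<open>1 \<le> k \<le> n\<close>: whenever \<open>t\<close> satisfies the defining inequality of the threshold, so does the grid
  point with \<open>k = R(t) \<or> 1\<close>, which is at least \<open>t\<close>. Hence \<open>\<tau> = \<alpha> * K / n\<close>, where \<open>K\<close> is the
  largest \<open>k\<close> with \<open>k \<le> max (R (\<alpha> * k / n)) 1\<close>, and maximality forces \<open>K = R(\<tau>) \<or> 1\<close>
  (\<open>threshold_eq_bh_level\<close>, \<open>bh_level_eq_count\<close>). Replacing each observation by its rank \<open>r\<^sub>i\<close> in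
  the chain of grid regions turns the procedure into the step-up procedure of Benjamini and
  Hochberg on integers: \<open>H\<^sub>i\<close> is rejected iff \<open>r\<^sub>i \<le> K\<close>.

  Let \<open>K\<^sub>i\<close> be the level obtained when \<open>r\<^sub>i\<close> is replaced by \<open>0\<close>. Then \<open>r\<^sub>i \<le> K\<close> is equivalent to
  \<open>r\<^sub>i \<le> K\<^sub>i\<close>, and in this case \<open>K = K\<^sub>i\<close> (\<open>bh_level_leave_one_out\<close>). As \<open>K\<^sub>i\<close> depends on the other
  pairs only, it is independent of \<open>(\<theta>\<^sub>i, r\<^sub>i)\<close>. The contribution of \<open>H\<^sub>i\<close> to the false discovery
  rate is therefore
  \[ \sum_{k=1}^n \frac{P(\theta_i = 0, r_i \le k)\, P(K_i = k)}{k}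
     = \sum_{k=1}^n \frac{(1 - a)\,\alpha k / n}{k}\, P(K_i = k) = \frac{(1 - a)\,\alpha}{n}. \]
  The factor \<open>k\<close> in the null probability cancels the denominator, which is why the result is an
  equality and does not involve \<open>g\<close>. The sum over the \<open>n\<close> hypotheses gives \<open>(1 - a) * \<alpha>\<close>. The
  null probability itself holds because independent uniform coordinates make the null law
  Lebesgue measure on the cube (\<open>distr_vec_uniform\<close>), so that the grid regions have null
  probability equal to their volume.
\<close>

section \<open>The step-up level on integer ranks\<close>

text \<open>The number of rejections, with \<open>0\<close> counted as \<open>1\<close>, of the Benjamini--Hochberg procedure when
  \<open>r j \<le> k\<close> is read as ``the \<open>j\<close>-th p-value is at most \<open>\<alpha> * k / n\<close>''.\<close>

definition bh_level :: "nat \<Rightarrow> (nat \<Rightarrow> nat) \<Rightarrow> nat" where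
  "bh_level n r = Max {k \<in> {1..n}. k \<le> max (card {j \<in> {1..n}. r j \<le> k}) 1}"

lemma bh_level_mem:
  assumes "1 \<le> n"
  shows "bh_level n r \<in> {1..n}" "bh_level n r \<le> max (card {j \<in> {1..n}. r j \<le> bh_level n r}) 1"
proof -
  have "bh_level n r \<in> {k \<in> {1..n}. k \<le> max (card {j \<in> {1..n}. r j \<le> k}) 1}"
    unfolding bh_level_def by (rule Max_in) (use assms in \<open>auto intro!: exI[of _ 1]\<close>)
  then show "bh_level n r \<in> {1..n}" "bh_level n r \<le> max (card {j \<in> {1..n}. r j \<le> bh_level n r}) 1"
    by auto
qed

lemma bh_level_ge:
  assumes "k \<in> {1..n}" "k \<le> max (card {j \<in> {1..n}. r j \<le> k}) 1"
  shows "k \<le> bh_level n r"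
  unfolding bh_level_def by (rule Max_ge) (use assms in auto)

lemma card_filter_atLeastAtMost_le: "card {j \<in> {1..n::nat}. P j} \<le> n"
  using card_mono[of "{1..n}" "{j \<in> {1..n}. P j}"] by (simp add: subset_iff)

text \<open>If the count at the level \<open>K\<close> were some \<open>m > K\<close>, then the count at \<open>m\<close> would be at least \<open>m\<close> too,
  because counts increase with the level; so \<open>m\<close> would be admissible, against maximality.\<close>

lemma bh_level_eq_count:
  assumes "1 \<le> n"
  shows "max (card {j \<in> {1..n}. r j \<le> bh_level n r}) 1 = bh_level n r"
proof (rule antisym)
  let ?c = "\<lambda>k. card {j \<in> {1..n}. r j \<le> k}" and ?m = "max (card {j \<in> {1..n}. r j \<le> bh_level n r}) 1"
  show "bh_level n r \<le> ?m" using bh_level_mem[OF assms] by blast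
  then have "?c (bh_level n r) \<le> ?c ?m"
    by (intro card_mono) auto
  moreover have "?m \<in> {1..n}"
    using assms card_filter_atLeastAtMost_le[of n "\<lambda>j. r j \<le> bh_level n r"] by auto
  ultimately show "?m \<le> bh_level n r"
    by (intro bh_level_ge) auto
qed

text \<open>Lowering a single rank can only raise the level. If \<open>r i\<close> is at most the raised level \<open>K'\<close>, then
  index \<open>i\<close> is counted at \<open>K'\<close> before and after the change, so \<open>K'\<close> was admissible from the start
  and the two levels agree.\<close>

lemma bh_level_leave_one_out:
  assumes "i \<in> {1..n}"
  shows "r i \<le> bh_level n r \<longleftrightarrow> r i \<le> bh_level n (r(i := 0))"
    and "r i \<le> bh_level n r \<Longrightarrow> bh_level n r = bh_level n (r(i := 0))"
proof -
  have n: "1 \<le> n" using assms by auto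
  let ?K = "bh_level n r" and ?K' = "bh_level n (r(i := 0))"
  have "card {j \<in> {1..n}. r j \<le> ?K} \<le> card {j \<in> {1..n}. (r(i := 0)) j \<le> ?K}"
    by (intro card_mono) auto
  then have le: "?K \<le> ?K'"
    using bh_level_mem[OF n, of r] by (intro bh_level_ge) auto
  have ge: "?K' \<le> ?K" if "r i \<le> ?K'"
  proof -
    have "{j \<in> {1..n}. (r(i := 0)) j \<le> ?K'} = {j \<in> {1..n}. r j \<le> ?K'}"
      using that by auto
    then show ?thesis
      using bh_level_mem[OF n, of "r(i := 0)"] by (intro bh_level_ge) auto
  qed
  show "r i \<le> ?K \<longleftrightarrow> r i \<le> ?K'" using le ge by fastforce
  show "r i \<le> ?K \<Longrightarrow> ?K = ?K'" using le ge by (meson antisym le_trans)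
qed

lemma bh_level_cong:
  assumes "\<And>j. j \<in> {1..n} \<Longrightarrow> r j = r' j"
  shows "bh_level n r = bh_level n r'"
proof -
  have "{j \<in> {1..n}. r j \<le> k} = {j \<in> {1..n}. r' j \<le> k}" for k
    using assms by auto
  then show ?thesis unfolding bh_level_def by simp
qed

text \<open>With the rank of \<open>i\<close> overwritten by \<open>0\<close>, the level is a function of the pairs with index
  different from \<open>i\<close>, hence independent of the pair \<open>i\<close>.\<close>

lemma (in prob_space) prob_bh_level_leave_one_out:
  fixes h :: "nat \<Rightarrow> 'a \<Rightarrow> bool" and r :: "nat \<Rightarrow> 'a \<Rightarrow> nat"
  assumes ind: "indep_vars (\<lambda>_. count_space UNIV) (\<lambda>i \<omega>. (h i \<omega>, r i \<omega>)) {1..n}"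
    and i: "i \<in> {1..n}"
  shows "prob {\<omega> \<in> space M. (h i \<omega> \<and> r i \<omega> \<le> k) \<and> bh_level n ((\<lambda>j. r j \<omega>)(i := 0)) = k}
    = prob {\<omega> \<in> space M. h i \<omega> \<and> r i \<omega> \<le> k} *
      prob {\<omega> \<in> space M. bh_level n ((\<lambda>j. r j \<omega>)(i := 0)) = k}"
proof -
  let ?X = "\<lambda>j \<omega>. (h j \<omega>, r j \<omega>)" and ?B = "{1..n} - {i}"
  let ?N = "\<lambda>f. bh_level n ((\<lambda>j. snd (f j :: bool \<times> nat))(i := 0))"
  have PiM: "PiM A (\<lambda>_. count_space (UNIV :: (bool \<times> nat) set)) = count_space (PiE A (\<lambda>_. UNIV))"
    if "A \<subseteq> {1..n}" for A
    using that finite_subset by (intro count_space_PiM_finite) auto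
  \<comment> \<open>Both maps go into the truth values because \<open>indep_var\<close> relates variables of one type.\<close>
  have "indep_var (PiM {i} (\<lambda>_. count_space UNIV)) (\<lambda>\<omega>. restrict (\<lambda>i. ?X i \<omega>) {i})
      (PiM ?B (\<lambda>_. count_space UNIV)) (\<lambda>\<omega>. restrict (\<lambda>i. ?X i \<omega>) ?B)"
    using i by (intro indep_var_restrict[OF ind]) auto
  then have "indep_var (count_space UNIV)
      ((\<lambda>f. fst (f i) \<and> snd (f i) \<le> k) \<circ> (\<lambda>\<omega>. restrict (\<lambda>i. ?X i \<omega>) {i}))
      (count_space UNIV) ((\<lambda>f. ?N f = k) \<circ> (\<lambda>\<omega>. restrict (\<lambda>i. ?X i \<omega>) ?B))"
    by (rule indep_var_compose) (use i in \<open>subst PiM, auto\<close>)+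
  from indep_varD[OF this, of "{True}" "{True}"]
  have eq: "prob {\<omega> \<in> space M. (h i \<omega> \<and> r i \<omega> \<le> k) \<and> ?N (restrict (\<lambda>i. ?X i \<omega>) ?B) = k}
     = prob {\<omega> \<in> space M. h i \<omega> \<and> r i \<omega> \<le> k} *
       prob {\<omega> \<in> space M. ?N (restrict (\<lambda>i. ?X i \<omega>) ?B) = k}"
    by (simp add: vimage_def Int_def conj_ac del: restrict_apply) (simp add: conj_ac)
  have N: "?N (restrict (\<lambda>i. ?X i \<omega>) ?B) = bh_level n ((\<lambda>j. r j \<omega>)(i := 0))" for \<omega>
    by (rule bh_level_cong) auto
  show ?thesis
    using eq unfolding N .
qed

text \<open>The linearity in \<open>k\<close> of the probability that a hypothesis is null with rank at most \<open>k\<close> cancels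
  the division by the level; what remains of the contribution of \<open>i\<close> is \<open>c\<close> times the total mass
  of the leave-one-out level.\<close>

lemma (in prob_space) expectation_bh_false_discovery_proportion:
  fixes h :: "nat \<Rightarrow> 'a \<Rightarrow> bool" and r :: "nat \<Rightarrow> 'a \<Rightarrow> nat"
  assumes n: "1 \<le> n"
    and ind: "indep_vars (\<lambda>_. count_space UNIV) (\<lambda>i \<omega>. (h i \<omega>, r i \<omega>)) {1..n}"
    and linear: "\<And>i k. i \<in> {1..n} \<Longrightarrow> k \<in> {1..n} \<Longrightarrow>
      prob {\<omega> \<in> space M. h i \<omega> \<and> r i \<omega> \<le> k} = c * real k"
  shows "expectation (\<lambda>\<omega>. real (card {i \<in> {1..n}. h i \<omega> \<and> r i \<omega> \<le> bh_level n (\<lambda>j. r j \<omega>)})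
      / real (bh_level n (\<lambda>j. r j \<omega>))) = real n * c"
proof -
  let ?N = "\<lambda>i \<omega>. bh_level n ((\<lambda>j. r j \<omega>)(i := 0))"
  let ?A = "\<lambda>i k. {\<omega> \<in> space M. (h i \<omega> \<and> r i \<omega> \<le> k) \<and> ?N i \<omega> = k}"
  have X: "(\<lambda>\<omega>. (h i \<omega>, r i \<omega>)) \<in> M \<rightarrow>\<^sub>M count_space UNIV" if "i \<in> {1..n}" for i
    using ind that by (auto simp: indep_vars_def)
  have h[measurable]: "h i \<in> M \<rightarrow>\<^sub>M count_space UNIV" if "i \<in> {1..n}" for i
    using measurable_compose[OF X[OF that], of fst] by simp
  have r[measurable]: "r i \<in> M \<rightarrow>\<^sub>M count_space UNIV" if "i \<in> {1..n}" for i
    using measurable_compose[OF X[OF that], of snd] by simp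
  have N_meas[measurable]: "?N i \<in> M \<rightarrow>\<^sub>M count_space UNIV" for i
  proof -
    have "(\<lambda>\<omega>. \<lambda>j\<in>{1..n}. r j \<omega>) \<in> M \<rightarrow>\<^sub>M PiM {1..n} (\<lambda>_. count_space UNIV)"
      by measurable
    then have "(\<lambda>\<omega>. \<lambda>j\<in>{1..n}. r j \<omega>) \<in> M \<rightarrow>\<^sub>M count_space (PiE {1..n} (\<lambda>_. UNIV))"
      by (subst (asm) count_space_PiM_finite) auto
    from measurable_compose[OF this, of "\<lambda>f. bh_level n (f(i := 0))" "count_space UNIV"]
    have "(\<lambda>\<omega>. bh_level n ((\<lambda>j\<in>{1..n}. r j \<omega>)(i := 0))) \<in> M \<rightarrow>\<^sub>M count_space UNIV"
      by simp
    moreover have "bh_level n ((\<lambda>j\<in>{1..n}. r j \<omega>)(i := 0)) = ?N i \<omega>" for \<omega>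
      by (rule bh_level_cong) auto
    ultimately show ?thesis by simp
  qed
  have A_meas: "?A i k \<in> events" if "i \<in> {1..n}" for i k
    using h[OF that] r[OF that] by measurable
  have decomp: "real (card {i \<in> {1..n}. h i \<omega> \<and> r i \<omega> \<le> bh_level n (\<lambda>j. r j \<omega>)})
      / real (bh_level n (\<lambda>j. r j \<omega>))
    = (\<Sum>i=1..n. \<Sum>k=1..n. indicator (?A i k) \<omega> / real k)" if \<omega>: "\<omega> \<in> space M" for \<omega>
  proof -
    let ?K = "bh_level n (\<lambda>j. r j \<omega>)"
    have "(\<Sum>k=1..n. indicator (?A i k) \<omega> / real k)
        = (if h i \<omega> \<and> r i \<omega> \<le> ?K then 1 / real ?K else 0)" if i: "i \<in> {1..n}" for i
    proof -
      have "(\<Sum>k=1..n. indicator (?A i k) \<omega> / real k)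
          = (\<Sum>k=1..n. if k = ?N i \<omega> then (if h i \<omega> \<and> r i \<omega> \<le> ?N i \<omega> then 1 / real (?N i \<omega>) else 0) else 0)"
        using \<omega> by (intro sum.cong) (auto simp: indicator_def)
      also have "\<dots> = (if h i \<omega> \<and> r i \<omega> \<le> ?N i \<omega> then 1 / real (?N i \<omega>) else 0)"
        using bh_level_mem(1)[OF n, of "(\<lambda>j. r j \<omega>)(i := 0)"] by (subst sum.delta) auto
      also have "\<dots> = (if h i \<omega> \<and> r i \<omega> \<le> ?K then 1 / real ?K else 0)"
        using bh_level_leave_one_out[OF i, of "\<lambda>j. r j \<omega>"] by auto
      finally show ?thesis .
    qed
    then have "(\<Sum>i=1..n. \<Sum>k=1..n. indicator (?A i k) \<omega> / real k)
        = (\<Sum>i=1..n. if h i \<omega> \<and> r i \<omega> \<le> ?K then 1 / real ?K else 0)"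
      by simp
    also have "\<dots> = (\<Sum>i \<in> {i \<in> {1..n}. h i \<omega> \<and> r i \<omega> \<le> ?K}. 1 / real ?K)"
      by (subst sum.inter_filter[symmetric]) auto
    finally show ?thesis by simp
  qed
  have "expectation (\<lambda>\<omega>. real (card {i \<in> {1..n}. h i \<omega> \<and> r i \<omega> \<le> bh_level n (\<lambda>j. r j \<omega>)})
      / real (bh_level n (\<lambda>j. r j \<omega>)))
    = expectation (\<lambda>\<omega>. \<Sum>i=1..n. \<Sum>k=1..n. indicator (?A i k) \<omega> / real k)"
    by (intro Bochner_Integration.integral_cong decomp refl)
  also have "\<dots> = (\<Sum>i=1..n. \<Sum>k=1..n. prob (?A i k) / real k)"
  proof -
    have int: "integrable M (\<lambda>\<omega>. indicator (?A i k) \<omega> / real k)" if "i \<in> {1..n}" for i k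
      using A_meas[OF that]
      by (intro integrable_divide integrable_real_indicator) (auto simp: emeasure_eq_measure)
    have "expectation (\<lambda>\<omega>. indicator (?A i k) \<omega> / real k) = prob (?A i k) / real k"
      if "i \<in> {1..n}" for i k
      using A_meas[OF that, of k] by simp
    then show ?thesis
      using int by (simp add: Bochner_Integration.integral_sum Bochner_Integration.integrable_sum
          del: integral_divide_zero)
  qed
  also have "\<dots> = (\<Sum>i=1..n. \<Sum>k=1..n. c * prob {\<omega> \<in> space M. ?N i \<omega> = k})"
    using prob_bh_level_leave_one_out[OF ind] linear by (intro sum.cong refl) auto
  also have "\<dots> = (\<Sum>i=1..n. c)"
  proof (intro sum.cong refl)
    fix i
    have "(\<Sum>k=1..n. prob {\<omega> \<in> space M. ?N i \<omega> = k}) = prob (\<Union>k\<in>{1..n}. {\<omega> \<in> space M. ?N i \<omega> = k})"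
      by (intro finite_measure_finite_Union[symmetric]) (auto simp: disjoint_family_on_def)
    also have "(\<Union>k\<in>{1..n}. {\<omega> \<in> space M. ?N i \<omega> = k}) = space M"
      using bh_level_mem(1)[OF n] by auto
    finally have "(\<Sum>k=1..n. prob {\<omega> \<in> space M. ?N i \<omega> = k}) = 1"
      by (simp only: prob_space)
    then show "(\<Sum>k=1..n. c * prob {\<omega> \<in> space M. ?N i \<omega> = k}) = c"
      by (simp only: sum_distrib_left[symmetric] mult_1_right)
  qed
  finally show ?thesis by simp
qed

section \<open>Uniform vectors on the cube\<close>

lemma box_vec_eq_INT:
  fixes l u :: "real ^ 'k"
  shows "box l u = (\<Inter>j. {x. x $ j \<in> {l $ j<..<u $ j}})"
  by (auto simp: mem_box_cart)

lemma box_vec_Int: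
  fixes l u l' u' :: "real ^ 'k"
  shows "box l u \<inter> box l' u' = box (\<chi> j. max (l $ j) (l' $ j)) (\<chi> j. min (u $ j) (u' $ j))"
  by (auto simp: set_eq_iff mem_box_cart)

lemma emeasure_lborel_box_vec:
  fixes l u :: "real ^ 'k"
  shows "emeasure lborel (box l u) = (\<Prod>j\<in>UNIV. emeasure lborel {l $ j<..<u $ j})"
proof (cases "\<forall>j. l $ j \<le> u $ j")
  case True
  have Basis: "(Basis :: (real ^ 'k) set) = range (\<lambda>j. axis j 1)"
    by (auto simp: Basis_vec_def)
  have "inj (\<lambda>j. axis j 1 :: real ^ 'k)"
    by (auto simp: inj_def axis_eq_axis)
  then have "(\<Prod>b\<in>Basis. (u - l) \<bullet> b) = (\<Prod>j\<in>UNIV. u $ j - l $ j)"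
    unfolding Basis by (subst prod.reindex) (auto simp: inner_axis)
  then show ?thesis
    using True by (subst emeasure_lborel_box) (auto simp: Basis inner_axis prod_ennreal)
next
  case False
  then obtain j where j: "u $ j < l $ j" by (auto simp: not_le)
  then have "box l u = {}"
    by (auto simp: set_eq_iff mem_box_cart intro!: exI[of _ j])
  moreover have "emeasure lborel {l $ j<..<u $ j} = 0"
    using j by simp
  then have "\<exists>j\<in>UNIV. emeasure lborel {l $ j<..<u $ j} = 0"
    by (rule bexI) simp
  from prod_zero[OF finite this] have "(\<Prod>j\<in>UNIV. emeasure lborel {l $ j<..<u $ j}) = 0"
    .
  ultimately show ?thesis by simp
qed

text \<open>The law of a vector is determined by its values on open boxes, where independence gives the
  product of the side probabilities, as does Lebesgue measure.\<close>

lemma (in prob_space) distr_vec_uniform: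
  fixes X :: "'a \<Rightarrow> real ^ 'k"
  assumes ind: "indep_vars (\<lambda>_. borel) (\<lambda>j \<omega>. X \<omega> $ j) UNIV"
    and unif: "\<And>j. distr M borel (\<lambda>\<omega>. X \<omega> $ j) = uniform_measure lborel {0<..<1}"
  shows "distr M borel X = uniform_measure lborel (box 0 1)"
proof (rule measure_eqI_generator_eq)
  have comp: "(\<lambda>\<omega>. X \<omega> $ j) \<in> borel_measurable M" for j
    using ind by (auto simp: indep_vars_def)
  then have X: "X \<in> borel_measurable M"
    by (auto simp: borel_measurable_euclidean_space[where f=X] Basis_vec_def inner_axis)
  let ?E = "range (\<lambda>(a, b). box a b :: (real ^ 'k) set)"
  show "Int_stable ?E"
    by (auto simp: Int_stable_def box_vec_Int)
  show "?E \<subseteq> Pow UNIV" "sets (distr M borel X) = sigma_sets UNIV ?E"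
    "sets (uniform_measure lborel (box 0 (1 :: real ^ 'k))) = sigma_sets UNIV ?E"
    by (simp_all add: borel_eq_box)
  let ?A = "\<lambda>n::nat. box (- (real n *\<^sub>R One)) (real n *\<^sub>R One) :: (real ^ 'k) set"
  show "range ?A \<subseteq> ?E" "(\<Union>i. ?A i) = UNIV"
    unfolding UN_box_eq_UNIV by auto
  show "emeasure (distr M borel X) (?A i) \<noteq> \<infinity>" for i
    using X by (simp add: emeasure_distr)
  show "emeasure (distr M borel X) B = emeasure (uniform_measure lborel (box 0 1)) B"
    if "B \<in> ?E" for B
  proof -
    obtain l u where B: "B = box l u" using \<open>B \<in> ?E\<close> by auto
    have unit: "emeasure lborel (box 0 (1 :: real ^ 'k)) = 1"
      by (simp add: emeasure_lborel_box_vec)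
    have "emeasure (distr M borel X) B = prob (X -` B \<inter> space M)"
      using X B by (simp add: emeasure_distr emeasure_eq_measure)
    also have "X -` B \<inter> space M = (\<Inter>j. (\<lambda>\<omega>. X \<omega> $ j) -` {l $ j<..<u $ j} \<inter> space M)"
      unfolding B box_vec_eq_INT by auto
    also have "ennreal (prob \<dots>) = (\<Prod>j\<in>UNIV. ennreal (prob ((\<lambda>\<omega>. X \<omega> $ j) -` {l $ j<..<u $ j} \<inter> space M)))"
      by (subst indep_varsD_finite[OF ind]) (auto simp: prod_ennreal)
    also have "\<dots> = (\<Prod>j\<in>UNIV. emeasure (distr M borel (\<lambda>\<omega>. X \<omega> $ j)) {l $ j<..<u $ j})"
      using comp by (simp add: emeasure_distr emeasure_eq_measure)
    also have "\<dots> = (\<Prod>j\<in>UNIV. emeasure lborel {max 0 (l $ j)<..<min 1 (u $ j)})"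
      unfolding unif by (simp add: Int_greaterThanLessThan divide_ennreal_def)
    also have "\<dots> = emeasure lborel (box 0 1 \<inter> B)"
      unfolding B box_vec_Int emeasure_lborel_box_vec by simp
    also have "\<dots> = emeasure (uniform_measure lborel (box 0 1)) B"
      using B unit by (simp add: divide_ennreal_def)
    finally show ?thesis .
  qed
qed

lemma unit_cube_eq_cbox: "unit_cube = cbox 0 1"
  by (auto simp: unit_cube_def mem_box_cart)

text \<open>The closed cube exceeds the open one by a null set, so that regions containing boundary points
  cause no loss.\<close>

lemma emeasure_uniform_box:
  assumes A: "A \<in> sets borel" "A \<subseteq> (unit_cube :: (real ^ 'k) set)"
  shows "emeasure (uniform_measure lborel (box 0 1)) A = emeasure lborel A"
proof -
  have unit: "emeasure lborel (box 0 (1 :: real ^ 'k)) = 1"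
    by (simp add: emeasure_lborel_box_vec)
  moreover have "emeasure lborel (cbox 0 (1 :: real ^ 'k)) = 1"
    using unit by (simp add: emeasure_lborel_cbox_eq emeasure_lborel_box_eq)
  ultimately have null: "emeasure lborel (cbox 0 1 - box 0 (1 :: real ^ 'k)) = 0"
    by (subst emeasure_Diff) (auto simp: box_subset_cbox)
  have "emeasure lborel (A - box 0 1) \<le> emeasure lborel (cbox 0 1 - box 0 (1 :: real ^ 'k))"
    using A by (intro emeasure_mono) (auto simp: unit_cube_eq_cbox)
  then have "emeasure lborel (A - box 0 1) = 0" using null by simp
  moreover have "emeasure lborel A = emeasure lborel (box 0 1 \<inter> A) + emeasure lborel (A - box 0 1)"
    using A by (subst plus_emeasure) (auto intro!: arg_cong[where f="emeasure lborel"])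
  ultimately show ?thesis
    using A unit by (simp add: divide_ennreal_def)
qed

lemma (in random_effects_model) random_variable_pair:
  assumes "i \<in> {1..n}"
  shows "\<theta> i \<in> M \<rightarrow>\<^sub>M count_space UNIV" "\<xi> i \<in> borel_measurable M"
proof -
  have p: "(\<lambda>\<omega>. (\<theta> i \<omega>, \<xi> i \<omega>)) \<in> M \<rightarrow>\<^sub>M count_space UNIV \<Otimes>\<^sub>M borel"
    using indep_pairs assms by (auto simp: indep_vars_def)
  show "\<theta> i \<in> M \<rightarrow>\<^sub>M count_space UNIV" "\<xi> i \<in> borel_measurable M"
    using measurable_compose[OF p measurable_fst] measurable_compose[OF p measurable_snd] by auto
qed

lemma (in random_effects_model) prob_null_region:
  assumes i: "i \<in> {1..n}" and a: "0 < a" "a < 1"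
    and A: "A \<in> sets borel" "A \<subseteq> unit_cube"
  shows "prob {\<omega> \<in> space M. \<not> \<theta> i \<omega> \<and> \<xi> i \<omega> \<in> A} = (1 - a) * measure lborel A"
proof -
  note [measurable] = random_variable_pair[OF i] A(1)
  let ?H = "{\<omega> \<in> space M. \<not> \<theta> i \<omega>}"
  have H: "?H \<in> events" by measurable
  have "prob ?H = measure (distr M (count_space UNIV) (\<theta> i)) {False}"
    by (subst measure_distr) (auto intro!: arg_cong[where f=prob])
  also have "\<dots> = 1 - a"
    using a unfolding \<theta>_bernoulli[OF i] by (simp add: measure_pmf_single)
  finally have pH: "prob ?H = 1 - a" .
  then have "emeasure M ?H \<noteq> 0" using a by (simp add: emeasure_eq_measure)
  then interpret U: prob_space "uniform_measure M ?H"
    by (rule prob_space_uniform_measure) simp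
  have law: "distr (uniform_measure M ?H) borel (\<xi> i) = uniform_measure lborel (box 0 1)"
    by (rule U.distr_vec_uniform[OF null_indep[OF i] null_uniform[OF i]])
  have "measure (uniform_measure M ?H) (\<xi> i -` A \<inter> space M) = measure lborel A"
    using arg_cong[OF law, of "\<lambda>N. measure N A"] emeasure_uniform_box[OF A]
    by (subst (asm) measure_distr) (auto simp: measure_def)
  then have "prob (?H \<inter> (\<xi> i -` A \<inter> space M)) = (1 - a) * measure lborel A"
    using a pH by (subst (asm) measure_uniform_measure) (auto simp: emeasure_eq_measure field_simps)
  moreover have "?H \<inter> (\<xi> i -` A \<inter> space M) = {\<omega> \<in> space M. \<not> \<theta> i \<omega> \<and> \<xi> i \<omega> \<in> A}"
    by auto
  ultimately show ?thesis by simp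
qed

section \<open>Reduction to ranks\<close>

text \<open>For an increasing chain \<open>A 1, ..., A n\<close> this is the least \<open>k\<close> with \<open>x \<in> A k\<close>, or \<open>n + 1\<close> if
  there is none. Counting the sets that miss \<open>x\<close> makes its measurability immediate.\<close>

definition nested_rank :: "(nat \<Rightarrow> 'b set) \<Rightarrow> nat \<Rightarrow> 'b \<Rightarrow> nat" where
  "nested_rank A n x = Suc (card {k \<in> {1..n}. x \<notin> A k})"

lemma nested_rank_le_iff:
  assumes nested: "\<And>k l. 1 \<le> k \<Longrightarrow> k \<le> l \<Longrightarrow> l \<le> n \<Longrightarrow> A k \<subseteq> A l" and k: "k \<in> {1..n}"
  shows "nested_rank A n x \<le> k \<longleftrightarrow> x \<in> A k"
proof
  assume "x \<in> A k"
  then have "x \<in> A l" if "k \<le> l" "l \<le> n" for l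
    using nested[of k l] that k by auto
  then have "{l \<in> {1..n}. x \<notin> A l} \<subseteq> {1..<k}"
    by (auto simp: not_le[symmetric])
  from card_mono[OF _ this] show "nested_rank A n x \<le> k"
    using k by (auto simp: nested_rank_def)
next
  assume le: "nested_rank A n x \<le> k"
  show "x \<in> A k"
  proof (rule ccontr)
    assume "x \<notin> A k"
    then have "x \<notin> A l" if "1 \<le> l" "l \<le> k" for l
      using nested[OF that] k by auto
    then have "{1..k} \<subseteq> {l \<in> {1..n}. x \<notin> A l}"
      using k by auto
    from card_mono[OF _ this] show False
      using le by (simp add: nested_rank_def)
  qed
qed

lemma region_count_eq_card: "region_count n \<xi> D \<omega> t = card {j \<in> {1..n}. \<xi> j \<omega> \<in> D t}"
  by (simp add: region_count_def indicator_def sum.If_cases Int_def)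

text \<open>The supremum is attained at the grid point of the step-up level: a point \<open>t\<close> of the set is
  dominated by the grid point \<open>\<alpha> * m / n\<close> with \<open>m = max (R t) 1\<close>, and \<open>R\<close> at that grid point is
  at least \<open>R t\<close>, so \<open>m\<close> is admissible for the step-up level.\<close>

lemma threshold_eq_bh_level:
  fixes D :: "real \<Rightarrow> (real ^ 'k) set"
  assumes n: "1 \<le> n" and \<alpha>: "0 < \<alpha>" "\<alpha> < 1"
    and mono: "\<And>s t. 0 \<le> s \<Longrightarrow> s \<le> t \<Longrightarrow> t \<le> 1 \<Longrightarrow> D s \<subseteq> D t"
    and rank: "\<And>j k. j \<in> {1..n} \<Longrightarrow> k \<in> {1..n} \<Longrightarrow>
      r j \<le> k \<longleftrightarrow> \<xi> j \<omega> \<in> D (\<alpha> * real k / real n)"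
  shows "threshold n \<alpha> \<xi> D \<omega> = \<alpha> * real (bh_level n r) / real n"
  unfolding threshold_def
proof (rule cSup_eq_maximum)
  let ?S = "{t \<in> {0..1}. t / \<alpha> \<le> real (max (region_count n \<xi> D \<omega> t) 1) / real n}"
  have n0: "0 < real n" using n by simp
  have grid: "\<alpha> * real k / real n \<in> {0..1}" if "k \<in> {1..n}" for k
  proof -
    have "\<alpha> * real k \<le> 1 * real n" using that \<alpha> by (intro mult_mono) auto
    then show ?thesis using \<alpha> n0 by simp
  qed
  have count: "region_count n \<xi> D \<omega> (\<alpha> * real k / real n) = card {j \<in> {1..n}. r j \<le> k}"
    if "k \<in> {1..n}" for k
    unfolding region_count_eq_card by (intro arg_cong[where f=card] Collect_cong) (use rank that in auto)
  show "\<alpha> * real (bh_level n r) / real n \<in> ?S"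
    using grid[OF bh_level_mem(1)[OF n, of r]] count[OF bh_level_mem(1)[OF n, of r]]
      bh_level_mem(2)[OF n, of r] \<alpha> n0 by (simp add: divide_right_mono)
  fix t assume t: "t \<in> ?S"
  let ?m = "max (region_count n \<xi> D \<omega> t) 1"
  have m: "?m \<in> {1..n}"
    using n card_filter_atLeastAtMost_le[of n "\<lambda>j. \<xi> j \<omega> \<in> D t"]
    by (auto simp: region_count_eq_card)
  have t_le: "t \<le> \<alpha> * real ?m / real n"
    using t \<alpha> n0 by (simp add: field_simps)
  have "region_count n \<xi> D \<omega> t \<le> region_count n \<xi> D \<omega> (\<alpha> * real ?m / real n)"
    unfolding region_count_eq_card[of n \<xi> D \<omega>]
    using mono[of t "\<alpha> * real ?m / real n"] t t_le grid[OF m]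
    by (intro card_mono) (auto simp: region_count_eq_card)
  then have "?m \<le> bh_level n r"
    unfolding count[OF m] using m by (intro bh_level_ge) auto
  then show "t \<le> \<alpha> * real (bh_level n r) / real n"
    using t_le \<alpha> n0
    by (meson divide_right_mono mult_left_mono of_nat_mono less_imp_le order_trans)
qed

theorem theorem3p1:
  fixes M :: "'a measure" and n :: nat and a \<alpha> :: real
    and g :: "real ^ 'k \<Rightarrow> real"
    and \<theta> :: "nat \<Rightarrow> 'a \<Rightarrow> bool" and \<xi> :: "nat \<Rightarrow> 'a \<Rightarrow> real ^ 'k"
    and D :: "real \<Rightarrow> (real ^ 'k) set"
  assumes "1 \<le> n" and "0 < a" and "a < 1"
    and "random_effects_model M n a g \<theta> \<xi>"
    and "\<And>t. t \<in> {0..1} \<Longrightarrow> D t \<in> sets borel"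
    and "D 1 = unit_cube"
    and "\<And>t. t \<in> {0..1} \<Longrightarrow> emeasure lborel (D t) = ennreal t"
    and "\<And>s t. 0 \<le> s \<Longrightarrow> s < t \<Longrightarrow> t \<le> 1 \<Longrightarrow> D s \<subseteq> D t"
    and "\<And>t. 0 \<le> t \<Longrightarrow> t < 1 \<Longrightarrow> D t = (\<Inter>s\<in>{t<..1}. D s)"
    and "0 < \<alpha>" and "\<alpha> < 1"
  shows "FDR M \<theta> (rejections n \<alpha> \<xi> D) = (1 - a) * \<alpha>"
proof -
  interpret random_effects_model M n a g \<theta> \<xi> by fact
  have n0: "0 < real n" using \<open>1 \<le> n\<close> by simp
  have mono: "D s \<subseteq> D t" if "0 \<le> s" "s \<le> t" "t \<le> 1" for s t
    using assms(8)[of s t] that by (cases "s = t") auto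
  define A where "A k = D (\<alpha> * real k / real n)" for k
  have grid: "\<alpha> * real k / real n \<in> {0..1}" if "k \<in> {1..n}" for k
  proof -
    have "\<alpha> * real k \<le> 1 * real n"
      using that \<open>0 < \<alpha>\<close> \<open>\<alpha> < 1\<close> by (intro mult_mono) auto
    then show ?thesis using \<open>0 < \<alpha>\<close> n0 by simp
  qed
  have A_borel: "A k \<in> sets borel" if "k \<in> {1..n}" for k
    unfolding A_def using assms(5) grid[OF that] by blast
  have A_cube: "A k \<subseteq> unit_cube" if "k \<in> {1..n}" for k
    unfolding A_def \<open>D 1 = unit_cube\<close>[symmetric] using mono grid[OF that] by simp
  have A_mono: "A k \<subseteq> A l" if "1 \<le> k" "k \<le> l" "l \<le> n" for k l
    unfolding A_def using grid[of k] grid[of l] that \<open>0 < \<alpha>\<close> n0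
    by (intro mono) (auto intro!: divide_right_mono mult_left_mono)
  define r where "r j \<omega> = nested_rank A n (\<xi> j \<omega>)" for j \<omega>
  have rank: "r j \<omega> \<le> k \<longleftrightarrow> \<xi> j \<omega> \<in> A k" if "k \<in> {1..n}" for j k \<omega>
    unfolding r_def using A_mono that by (rule nested_rank_le_iff)
  have rank_meas: "nested_rank A n \<in> borel \<rightarrow>\<^sub>M count_space UNIV"
  proof -
    have "{x \<in> space borel. k \<in> {k \<in> {1..n}. x \<notin> A k}} \<in> sets borel" for k
    proof (cases "k \<in> {1..n}")
      case True
      then have "{x \<in> space borel. k \<in> {k \<in> {1..n}. x \<notin> A k}} = space borel - A k" by auto
      then show ?thesis using sets.compl_sets[OF A_borel[OF True]] by argo
    next
      case False
      then have "{x \<in> space borel. k \<in> {k \<in> {1..n}. x \<notin> A k}} = {}" by blast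
      then show ?thesis by (simp only: sets.empty_sets)
    qed
    from measurable_compose[OF measurable_card[OF this], of Suc "count_space UNIV"]
    show ?thesis unfolding nested_rank_def[abs_def] by (simp only: measurable_count_space)
  qed
  have "indep_vars (\<lambda>_. count_space UNIV)
      (\<lambda>j \<omega>. (\<lambda>(b, x). (\<not> b, nested_rank A n x)) (\<theta> j \<omega>, \<xi> j \<omega>)) {1..n}"
  proof (rule indep_vars_compose2[OF indep_pairs])
    have "(\<lambda>p. (\<not> fst p, nested_rank A n (snd p))) \<in>
        count_space UNIV \<Otimes>\<^sub>M borel \<rightarrow>\<^sub>M count_space UNIV \<Otimes>\<^sub>M count_space UNIV"
      using rank_meas by measurable
    then show "(\<lambda>(b, x). (\<not> b, nested_rank A n x)) \<in> count_space UNIV \<Otimes>\<^sub>M borel \<rightarrow>\<^sub>M count_space UNIV"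
      by (simp add: pair_measure_countable case_prod_unfold)
  qed
  then have ind: "indep_vars (\<lambda>_. count_space UNIV) (\<lambda>j \<omega>. (\<not> \<theta> j \<omega>, r j \<omega>)) {1..n}"
    by (simp add: r_def)
  have linear: "prob {\<omega> \<in> space M. \<not> \<theta> i \<omega> \<and> r i \<omega> \<le> k} = (1 - a) * \<alpha> / real n * real k"
    if "i \<in> {1..n}" "k \<in> {1..n}" for i k
  proof -
    have "measure lborel (A k) = \<alpha> * real k / real n"
      using assms(7)[OF grid[OF that(2)]] grid[OF that(2)] by (simp add: A_def measure_def)
    then show ?thesis
      using prob_null_region[OF that(1) assms(2,3) A_borel A_cube, OF that(2) that(2)] rank[OF that(2)]
      by simp
  qed
  let ?K = "\<lambda>\<omega>. bh_level n (\<lambda>j. r j \<omega>)"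
  have rej: "rejections n \<alpha> \<xi> D \<omega> = {i \<in> {1..n}. r i \<omega> \<le> ?K \<omega>}" for \<omega>
  proof -
    have "threshold n \<alpha> \<xi> D \<omega> = \<alpha> * real (?K \<omega>) / real n"
      using assms mono rank by (intro threshold_eq_bh_level) (auto simp: A_def)
    then show ?thesis
      unfolding rejections_def using rank[OF bh_level_mem(1)[OF assms(1)]] by (simp add: A_def)
  qed
  have "FDR M \<theta> (rejections n \<alpha> \<xi> D)
      = expectation (\<lambda>\<omega>. real (card {i \<in> {1..n}. \<not> \<theta> i \<omega> \<and> r i \<omega> \<le> ?K \<omega>}) / real (?K \<omega>))"
    unfolding FDR_def rej bh_level_eq_count[OF assms(1)]
    by (intro arg_cong[where f=expectation] ext arg_cong2[where f="(/)"]
        arg_cong[where f=real] arg_cong[where f=card]) auto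
  also have "\<dots> = real n * ((1 - a) * \<alpha> / real n)"
    by (rule expectation_bh_false_discovery_proportion[OF assms(1) ind linear])
  finally show ?thesis using n0 by simp
qed

end
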